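(* Let $A_1\in\mathcal{M}$ be an irreducible matrix and $X_1\in\mathcal{V}$ an irreducible vector. Then the two lattices $\langle A_1\rangle$ and $\lceil X_1\rceil$ generated by $A_1$ and $X_1$ are isomorphic: the map $\varphi: A_s=A_1\otimes I_s\mapsto X_s=X_1\otimes\mathbf{1}_s$, $s=1,2,\dots$, is a lattice isomorphism from $(\langle A_1\rangle,\prec)$ to $(\lceil X_1\rceil,\leqslant)$.
   Context: $\mathcal{M}$ is the set of all finite-size matrices and $\mathcal{V}=\bigcup_{i\ge1}\mathcal{V}_i$ the set of all (column) vectors of all finite dimensions over a field $\mathbb{F}$ of characteristic $0$ ($\mathcal{V}_i$ is the $i$-dimensional space $\mathbb{F}^i$). $\otimes$ is the Kronecker product and $\mathbf{1}_s\in\mathbb{F}^s$ the all-ones column vector. $A\sim B$ means $A\otimes I_s=B\otimes I_t$ for some positive integers $s,t$, and $\langle A\rangle$ is the class of $A$; $B\prec C$ in $\langle A\rangle$ means $C=B\otimes I_s$ for some $s$. $A_1$ is irreducible if it is not of the form $B\otimes I_s$, $s\ge2$; then $\langle A_1\rangle=\{A_1\otimes I_s:s\ge1\}$. $X\leftrightarrow Y$ in $\mathcal{V}$ means $X\otimes\mathbf{1}_s=Y\otimes\mathbf{1}_t$ for some positive integers $s,t$, and $\lceil X\rceil$ is the class of $X$; $X\leqslant Y$ in a class means $Y=X\otimes\mathbf{1}_s$ for some $s$. $X_1$ is irreducible if it is not of the form $Y\otimes\mathbf{1}_s$, $s>1$; then $\lceil X_1\rceil=\{X_1\otimes\mathbf{1}_s:s\ge1\}$.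 Both posets are lattices. A lattice isomorphism is a bijection preserving sup and inf of pairs. *)

theory Defs
  imports "Jordan_Normal_Form.Matrix" "HOL-Algebra.Lattice"
begin

section \<open>Kronecker products\<close>

definition kron_mat :: "'a::times mat \<Rightarrow> 'a mat \<Rightarrow> 'a mat" where
  "kron_mat A B =
     mat (dim_row A * dim_row B) (dim_col A * dim_col B)
       (\<lambda>(i, j). A $$ (i div dim_row B, j div dim_col B) * B $$ (i mod dim_row B, j mod dim_col B))"

definition kron_vec :: "'a::times vec \<Rightarrow> 'a vec \<Rightarrow> 'a vec" where
  "kron_vec X Y = vec (dim_vec X * dim_vec Y) (\<lambda>i. X $ (i div dim_vec Y) * Y $ (i mod dim_vec Y))"

text \<open>The product of vectors is the product of the corresponding one-column matrices.\<close>

lemma kron_mat_mat_of_cols: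
  "kron_mat (mat_of_cols (dim_vec X) [X]) (mat_of_cols (dim_vec Y) [Y]) =
     mat_of_cols (dim_vec X * dim_vec Y) [kron_vec X Y]"
proof (rule eq_matI)
  fix i j
  assume "i < dim_row (mat_of_cols (dim_vec X * dim_vec Y) [kron_vec X Y])"
    and "j < dim_col (mat_of_cols (dim_vec X * dim_vec Y) [kron_vec X Y])"
  then have i: "i < dim_vec X * dim_vec Y" and j: "j = 0" by simp_all
  from i have "0 < dim_vec Y" by (cases "dim_vec Y") auto
  then have "i mod dim_vec Y < dim_vec Y" by simp
  moreover from i have "i div dim_vec Y < dim_vec X" by (simp add: less_mult_imp_div_less)
  ultimately show "kron_mat (mat_of_cols (dim_vec X) [X]) (mat_of_cols (dim_vec Y) [Y]) $$ (i, j) =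
      mat_of_cols (dim_vec X * dim_vec Y) [kron_vec X Y] $$ (i, j)"
    using i j by (simp add: kron_mat_def kron_vec_def mat_of_cols_def)
qed (simp_all add: kron_mat_def)

definition ones_vec :: "nat \<Rightarrow> 'a::one vec" where
  "ones_vec s = vec s (\<lambda>_. 1)"


section \<open>Matrices up to Kronecker multiplication with identity matrices\<close>

text \<open>The types of matrices and vectors also contain empty (zero-dimensional) objects, which are
  excluded here.\<close>

definition all_mats :: "'a mat set" where
  "all_mats = {A. 0 < dim_row A \<and> 0 < dim_col A}"

definition mat_equiv :: "'a::semiring_1 mat \<Rightarrow> 'a mat \<Rightarrow> bool" where
  "mat_equiv A B \<longleftrightarrow> (\<exists>s>0. \<exists>t>0. kron_mat A (1\<^sub>m s) = kron_mat B (1\<^sub>m t))"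

definition mat_class :: "'a::semiring_1 mat \<Rightarrow> 'a mat set" where
  "mat_class A = {B \<in> all_mats. mat_equiv A B}"

definition mat_prec :: "'a::semiring_1 mat \<Rightarrow> 'a mat \<Rightarrow> bool" where
  "mat_prec B C \<longleftrightarrow> (\<exists>s>0. C = kron_mat B (1\<^sub>m s))"

definition mat_irreducible :: "'a::semiring_1 mat \<Rightarrow> bool" where
  "mat_irreducible A \<longleftrightarrow> \<not> (\<exists>B\<in>all_mats. \<exists>s\<ge>2. A = kron_mat B (1\<^sub>m s))"

definition mat_class_order :: "'a::semiring_1 mat \<Rightarrow> 'a mat gorder" where
  "mat_class_order A = \<lparr>carrier = mat_class A, eq = (=), le = mat_prec\<rparr>"


section \<open>Vectors up to Kronecker multiplication with all-ones vectors\<close>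

definition all_vecs :: "'a vec set" where
  "all_vecs = {X. 0 < dim_vec X}"

definition vec_equiv :: "'a::semiring_1 vec \<Rightarrow> 'a vec \<Rightarrow> bool" where
  "vec_equiv X Y \<longleftrightarrow> (\<exists>s>0. \<exists>t>0. kron_vec X (ones_vec s) = kron_vec Y (ones_vec t))"

definition vec_class :: "'a::semiring_1 vec \<Rightarrow> 'a vec set" where
  "vec_class X = {Y \<in> all_vecs. vec_equiv X Y}"

definition vec_leq :: "'a::semiring_1 vec \<Rightarrow> 'a vec \<Rightarrow> bool" where
  "vec_leq X Y \<longleftrightarrow> (\<exists>s>0. Y = kron_vec X (ones_vec s))"

definition vec_irreducible :: "'a::semiring_1 vec \<Rightarrow> bool" where
  "vec_irreducible X \<longleftrightarrow> \<not> (\<exists>Y\<in>all_vecs. \<exists>s>1. X = kron_vec Y (ones_vec s))"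

definition vec_class_order :: "'a::semiring_1 vec \<Rightarrow> 'a vec gorder" where
  "vec_class_order X = \<lparr>carrier = vec_class X, eq = (=), le = vec_leq\<rparr>"


section \<open>Lattice isomorphisms\<close>

text \<open>Both orders are required to be lattices, so that joins and meets are genuine suprema and
  infima.\<close>

definition lattice_iso :: "'a gorder \<Rightarrow> 'b gorder \<Rightarrow> ('a \<Rightarrow> 'b) \<Rightarrow> bool" where
  "lattice_iso L M f \<longleftrightarrow>
     lattice L \<and> lattice M \<and> bij_betw f (carrier L) (carrier M) \<and>
     (\<forall>x\<in>carrier L. \<forall>y\<in>carrier L.
        f (x \<squnion>\<^bsub>L\<^esub> y) = f x \<squnion>\<^bsub>M\<^esub> f y \<and> f (x \<sqinter>\<^bsub>L\<^esub> y) = f x \<sqinter>\<^bsub>M\<^esub> f y)"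

end

theory Submission
  imports Defs "HOL-Number_Theory.Cong"
begin

text \<open>Suppose \<open>M = A \<otimes> I\<^sub>s = B \<otimes> I\<^sub>t\<close>, and let \<open>L\<close> be the least common multiple of \<open>s\<close> and \<open>t\<close>.
  An entry of \<open>M\<close> vanishes unless its indices agree modulo both \<open>s\<close> and \<open>t\<close>, hence modulo \<open>L\<close>; and
  passing from \<open>(i, j)\<close> to \<open>(i + 1, j + 1)\<close> can change a nonzero entry only at a common boundary of
  the \<open>s\<close>-blocks and the \<open>t\<close>-blocks, hence only at a multiple of \<open>L\<close>. Therefore \<open>M = C \<otimes> I\<^sub>L\<close>, and
  cancelling gives \<open>A = C \<otimes> I\<^bsub>L/s\<^esub>\<close>. If \<open>A\<close> is irreducible, then \<open>L = s\<close>, so \<open>t\<close> divides \<open>s\<close> and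
  \<open>B = A \<otimes> I\<^bsub>s/t\<^esub>\<close>. The same argument works for vectors. Thus both classes, ordered as in the
  statement, are copies of the positive integers ordered by divisibility.\<close>

section \<open>Orders isomorphic to divisibility of positive integers\<close>

text \<open>Only the order is transported along \<open>f\<close>; joins and meets then come from lcm
  and gcd. Fixing \<open>eq\<close> as equality makes antisymmetry identify elements, so suprema and
  infima are unique.\<close>

locale dvd_gorder =
  fixes M :: "'b gorder" and f :: "nat \<Rightarrow> 'b"
  assumes eq: "eq M = (=)"
    and bij: "bij_betw f {0<..} (carrier M)"
    and le: "\<lbrakk>0 < s; 0 < t\<rbrakk> \<Longrightarrow> le M (f s) (f t) \<longleftrightarrow> s dvd t"
begin

lemma f_closed: "0 < s \<Longrightarrow> f s \<in> carrier M"
  using bij by (auto simp: bij_betw_def)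

lemma carrierE:
  assumes "x \<in> carrier M"
  obtains s where "0 < s" "x = f s"
  using assms bij by (auto simp: bij_betw_def)

lemma partial_order: "partial_order M"
proof
  fix x y assume "le M x y" "le M y x" "x \<in> carrier M" "y \<in> carrier M"
  then show "eq M x y"
    by (metis carrierE dvd_antisym eq le)
next
  fix x y z assume "le M x y" "le M y z" "x \<in> carrier M" "y \<in> carrier M" "z \<in> carrier M"
  then show "le M x z"
    by (metis carrierE dvd_trans le)
next
  fix x assume "x \<in> carrier M"
  then show "le M x x"
    by (metis carrierE dvd_refl le)
qed (simp_all add: eq)

lemma least_lcm:
  assumes s: "0 < s" and t: "0 < t"
  shows "least M (f (lcm s t)) (Upper M {f s, f t})"
proof (rule least_UpperI)
  have L: "0 < lcm s t" using s t by (simp add: lcm_pos_nat)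
  show "le M x (f (lcm s t))" if "x \<in> {f s, f t}" for x
    using that s t L by (auto simp: le)
  show "le M (f (lcm s t)) y" if "y \<in> Upper M {f s, f t}" for y
  proof -
    have y: "y \<in> carrier M" "le M (f s) y" "le M (f t) y"
      using that f_closed s t by (auto simp: Upper_def)
    then show ?thesis using s t L
      by (metis carrierE le lcm_least)
  qed
  show "f (lcm s t) \<in> carrier M" using L by (rule f_closed)
qed (use f_closed s t in auto)

lemma greatest_gcd:
  assumes s: "0 < s" and t: "0 < t"
  shows "greatest M (f (gcd s t)) (Lower M {f s, f t})"
proof (rule greatest_LowerI)
  have L: "0 < gcd s t" using s by simp
  show "le M (f (gcd s t)) x" if "x \<in> {f s, f t}" for x
    using that s t L by (auto simp: le)
  show "le M y (f (gcd s t))" if "y \<in> Lower M {f s, f t}" for y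
  proof -
    have y: "y \<in> carrier M" "le M y (f s)" "le M y (f t)"
      using that f_closed s t by (auto simp: Lower_def)
    then show ?thesis using s t L
      by (metis carrierE le gcd_greatest)
  qed
  show "f (gcd s t) \<in> carrier M" using L by (rule f_closed)
qed (use f_closed s t in auto)

lemma lattice: "lattice M"
proof -
  interpret partial_order M by (rule partial_order)
  show ?thesis
  proof
    fix x y assume "x \<in> carrier M" "y \<in> carrier M"
    then obtain s t where "0 < s" "x = f s" "0 < t" "y = f t"
      by (metis carrierE)
    then show "\<exists>z. least M z (Upper M {x, y})" "\<exists>z. greatest M z (Lower M {x, y})"
      using least_lcm greatest_gcd by blast+
  qed
qed

text \<open>\<open>sup\<close> is a Hilbert choice among least upper bounds; uniqueness in a partial
  order forces the chosen element to be the one indexed by the lcm.\<close>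

lemma join_eq_lcm:
  assumes "0 < s" "0 < t"
  shows "f s \<squnion>\<^bsub>M\<^esub> f t = f (lcm s t)"
  unfolding join_def sup_def
  using least_lcm[OF assms] partial_order.least_unique[OF partial_order] by blast

lemma meet_eq_gcd:
  assumes "0 < s" "0 < t"
  shows "f s \<sqinter>\<^bsub>M\<^esub> f t = f (gcd s t)"
  unfolding meet_def inf_def
  using greatest_gcd[OF assms] partial_order.greatest_unique[OF partial_order] by blast

end

text \<open>On both sides joins are lcms and meets are gcds of indices, so the bijection that
  matches indices preserves them.\<close>

lemma lattice_iso_dvd_gorder:
  assumes L: "dvd_gorder L f" and M: "dvd_gorder M g"
  shows "\<exists>\<phi>. (\<forall>s\<ge>1. \<phi> (f s) = g s) \<and> lattice_iso L M \<phi>"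
proof -
  interpret L: dvd_gorder L f by (rule L)
  interpret M: dvd_gorder M g by (rule M)
  define \<phi> where "\<phi> = g \<circ> inv_into {0<..} f"
  have \<phi>: "\<phi> (f s) = g s" if "0 < s" for s
    using that L.bij by (simp add: \<phi>_def bij_betw_def)
  have "bij_betw \<phi> (carrier L) (carrier M)"
    unfolding \<phi>_def using bij_betw_inv_into[OF L.bij] M.bij by (rule bij_betw_trans)
  moreover have "\<phi> (x \<squnion>\<^bsub>L\<^esub> y) = \<phi> x \<squnion>\<^bsub>M\<^esub> \<phi> y \<and> \<phi> (x \<sqinter>\<^bsub>L\<^esub> y) = \<phi> x \<sqinter>\<^bsub>M\<^esub> \<phi> y"
    if xy: "x \<in> carrier L" "y \<in> carrier L" for x y
  proof -
    obtain s t where "0 < s" "x = f s" "0 < t" "y = f t"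
      using xy by (metis L.carrierE)
    then show ?thesis
      by (simp add: \<phi> L.join_eq_lcm M.join_eq_lcm L.meet_eq_gcd M.meet_eq_gcd lcm_pos_nat)
  qed
  ultimately have "lattice_iso L M \<phi>"
    using L.lattice M.lattice by (auto simp: lattice_iso_def)
  moreover have "\<forall>s\<ge>1. \<phi> (f s) = g s" using \<phi> by simp
  ultimately show ?thesis by blast
qed

section \<open>Classes of an action of the positive integers\<close>

text \<open>The instances are \<open>act A s = A \<otimes> I\<^sub>s\<close> on matrices and \<open>act X s = X \<otimes> 1\<^sub>s\<close> on vectors.\<close>

locale nat_action =
  fixes S :: "'b set" and act :: "'b \<Rightarrow> nat \<Rightarrow> 'b"
  assumes closed: "\<lbrakk>x \<in> S; 0 < s\<rbrakk> \<Longrightarrow> act x s \<in> S"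
    and act_1: "act x 1 = x"
    and act_act: "act (act x s) t = act x (s * t)"
    and cancel: "\<lbrakk>0 < s; act x s = act y s\<rbrakk> \<Longrightarrow> x = y"
    and free: "\<lbrakk>x \<in> S; act x s = act x t\<rbrakk> \<Longrightarrow> s = t"
    and act_lcm: "\<lbrakk>x \<in> S; y \<in> S; 0 < s; 0 < t; act x s = act y t\<rbrakk>
      \<Longrightarrow> \<exists>z\<in>S. act x s = act z (lcm s t)"
begin

text \<open>The hard inclusion between the class of \<open>x\<close> and its set of multiples.
  Writing \<open>lcm s t = k * s\<close> and cancelling \<open>s\<close> exhibits \<open>x\<close>
  as a \<open>k\<close>-fold multiple, so irreducibility leaves only \<open>k = 1\<close>, that is,
  \<open>t dvd s\<close>.\<close>

lemma irreducible_imp_multiple: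
  assumes x: "x \<in> S" and irr: "\<not> (\<exists>z\<in>S. \<exists>k\<ge>2. x = act z k)"
    and y: "y \<in> S" and s: "0 < s" and t: "0 < t" and eq: "act x s = act y t"
  shows "\<exists>k>0. y = act x k"
proof -
  obtain z where z: "z \<in> S" "act x s = act z (lcm s t)"
    using act_lcm[OF x y s t eq] by blast
  obtain k where k: "lcm s t = k * s"
    by (metis dvd_def dvd_lcm1 mult.commute)
  have "x = act z k"
    using z(2) s by (auto simp: k act_act[symmetric] intro: cancel)
  then have "\<not> k \<ge> 2" using irr z(1) by blast
  moreover have "0 < lcm s t" using s t by (simp add: lcm_pos_nat)
  ultimately have "k = 1" using k by (cases k) auto
  then have "t dvd s" by (metis dvd_lcm2 k mult_1)
  then obtain m where m: "s = m * t" by (metis dvd_def mult.commute)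
  then have "act (act x m) t = act y t" using eq by (simp add: act_act)
  then have "y = act x m" using cancel t by metis
  then show ?thesis using m s by (auto intro: exI[of _ m])
qed

text \<open>The record has the shape of \<open>mat_class_order\<close> and
  \<open>vec_class_order\<close>, so that both instances follow by unfolding.\<close>

lemma dvd_gorder_class:
  assumes x: "x \<in> S" and irr: "\<not> (\<exists>z\<in>S. \<exists>k\<ge>2. x = act z k)"
  shows "dvd_gorder \<lparr>carrier = {y \<in> S. \<exists>s>0. \<exists>t>0. act x s = act y t}, eq = (=),
      le = (\<lambda>y z. \<exists>s>0. z = act y s)\<rparr> (act x)"
proof
  have "act x ` {0<..} = {y \<in> S. \<exists>s>0. \<exists>t>0. act x s = act y t}"
  proof (intro equalityI subsetI)
    fix y assume "y \<in> act x ` {0<..}"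
    then obtain s where s: "0 < s" "y = act x s" by auto
    then have "act x s = act y 1" "(0::nat) < 1" by (simp_all only: act_1 zero_less_one)
    then show "y \<in> {y \<in> S. \<exists>s>0. \<exists>t>0. act x s = act y t}"
      using s closed[OF x] by blast
  next
    fix y assume "y \<in> {y \<in> S. \<exists>s>0. \<exists>t>0. act x s = act y t}"
    then show "y \<in> act x ` {0<..}"
      using irreducible_imp_multiple[OF x irr] by blast
  qed
  moreover have "inj_on (act x) {0<..}"
    using free[OF x] by (auto intro: inj_onI)
  ultimately show "bij_betw (act x) {0<..} (carrier \<lparr>carrier =
      {y \<in> S. \<exists>s>0. \<exists>t>0. act x s = act y t}, eq = (=), le = (\<lambda>y z. \<exists>s>0. z = act y s)\<rparr>)"
    by (simp add: bij_betw_def)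
next
  fix s t :: nat assume "0 < s" "0 < t"
  \<comment> \<open>Freeness turns the order into divisibility of indices; the positive factor
    demanded by \<open>le\<close> comes from \<open>0 < t\<close>.\<close>
  moreover have "act x t = act x (s * k) \<longleftrightarrow> t = s * k" for k
    using free[OF x] by auto
  ultimately show "le \<lparr>carrier = {y \<in> S. \<exists>s>0. \<exists>t>0. act x s = act y t}, eq = (=),
      le = (\<lambda>y z. \<exists>s>0. z = act y s)\<rparr> (act x s) (act x t) \<longleftrightarrow> s dvd t"
    by (auto simp: act_act dvd_def)
qed simp

end

section \<open>Kronecker products with identity matrices and all-ones vectors\<close>

lemma constant_below:
  assumes "\<And>k. Suc k < L \<Longrightarrow> h (Suc k) = h k"
  shows "k < L \<Longrightarrow> h k = h 0"
  by (induction k) (auto simp: assms)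

text \<open>A quotient by \<open>d\<close> jumps only at multiples of \<open>d\<close>, and
  \<open>Suc k\<close>, lying strictly inside a block, is not a multiple of both \<open>s\<close>
  and \<open>t\<close>. Each disjunct quantifies over \<open>a\<close> because a matrix entry needs
  the same alternative for its row block and its column block.\<close>

lemma Suc_div_in_lcm_block:
  fixes s t :: nat
  assumes "Suc k < lcm s t"
  shows "(\<forall>a. (a * lcm s t + Suc k) div s = (a * lcm s t + k) div s) \<or>
         (\<forall>a. (a * lcm s t + Suc k) div t = (a * lcm s t + k) div t)"
proof -
  have "\<not> lcm s t dvd Suc k" using assms by (meson dvd_imp_le not_less zero_less_Suc)
  then have "\<not> s dvd Suc k \<or> \<not> t dvd Suc k" using lcm_least by blast
  moreover have "(a * lcm s t + Suc k) div d = (a * lcm s t + k) div d"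
    if "\<not> d dvd Suc k" "d dvd lcm s t" for a d
  proof -
    have "\<not> d dvd Suc (a * lcm s t + k)"
      using that by (metis add_Suc_right dvd_add_right_iff dvd_mult)
    then show ?thesis by (simp add: div_Suc dvd_eq_mod_eq_0)
  qed
  ultimately show ?thesis by (metis dvd_lcm1 dvd_lcm2)
qed

lemma dim_kron_mat_one [simp]:
  "dim_row (kron_mat A (1\<^sub>m s)) = dim_row A * s"
  "dim_col (kron_mat A (1\<^sub>m s)) = dim_col A * s"
  by (simp_all add: kron_mat_def)

lemma mod_less_of_less_mult: "(i::nat) < m * s \<Longrightarrow> i mod s < s"
  by (cases s) auto

lemma index_kron_mat_one:
  fixes A :: "'a::semiring_1 mat"
  assumes "i < dim_row A * s" "j < dim_col A * s"
  shows "kron_mat A (1\<^sub>m s) $$ (i, j) = (if i mod s = j mod s then A $$ (i div s, j div s) else 0)"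
  using assms by (simp add: kron_mat_def mod_less_of_less_mult)

lemma dim_kron_vec_ones [simp]: "dim_vec (kron_vec X (ones_vec s)) = dim_vec X * s"
  by (simp add: kron_vec_def ones_vec_def)

lemma index_kron_vec_ones:
  fixes X :: "'a::semiring_1 vec"
  assumes "i < dim_vec X * s"
  shows "kron_vec X (ones_vec s) $ i = X $ (i div s)"
  using assms by (simp add: kron_vec_def ones_vec_def mod_less_of_less_mult)

text \<open>A residue modulo \<open>s * t\<close> is a pair of mixed-radix digits. This gives the
  entrywise form of \<open>I_s\<close> times \<open>I_t\<close> being
  \<open>I_(s*t)\<close>.\<close>

lemma mod_mult_eq_iff:
  fixes i j s t :: nat
  shows "i mod (s * t) = j mod (s * t) \<longleftrightarrow>
    i mod t = j mod t \<and> (i div t) mod s = (j div t) mod s"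
proof
  assume eq: "i mod (s * t) = j mod (s * t)"
  have "x div t mod s = x mod (s * t) div t" for x
    by (cases "t = 0") (simp_all add: mult.commute[of s] mod_mult2_eq)
  moreover have "x mod t = x mod (s * t) mod t" for x
    by (simp add: mod_mod_cancel)
  ultimately show "i mod t = j mod t \<and> (i div t) mod s = (j div t) mod s"
    using eq by metis
qed (simp add: mult.commute[of s] mod_mult2_eq)

section \<open>Descent to the least common multiple\<close>

lemma kron_mat_lcm:
  fixes A B :: "'a::semiring_1 mat"
  assumes eq: "kron_mat A (1\<^sub>m s) = kron_mat B (1\<^sub>m t)" and s: "0 < s" and t: "0 < t"
    and A: "A \<in> all_mats"
  shows "\<exists>C\<in>all_mats. kron_mat A (1\<^sub>m s) = kron_mat C (1\<^sub>m (lcm s t))"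
proof -
  define M where "M = kron_mat A (1\<^sub>m s)"
  define L where "L = lcm s t"
  have L: "0 < L" using s t by (simp add: L_def lcm_pos_nat)
  have row: "dim_row M = dim_row A * s" "dim_row M = dim_row B * t"
    and col: "dim_col M = dim_col A * s" "dim_col M = dim_col B * t"
    by (simp add: M_def, simp add: M_def eq, simp add: M_def, simp add: M_def eq)
  have "L dvd dim_row M" "L dvd dim_col M"
    unfolding L_def using row col by (metis dvd_triv_right lcm_least)+
  then obtain m n where m: "dim_row M = m * L" and n: "dim_col M = n * L"
    by (metis dvd_def mult.commute)
  have "0 < m" "0 < n"
    using A row(1) col(1) m n s by (auto simp: all_mats_def intro: Nat.gr0I)
  have MA: "M $$ (i, j) = (if i mod s = j mod s then A $$ (i div s, j div s) else 0)"
    and MB: "M $$ (i, j) = (if i mod t = j mod t then B $$ (i div t, j div t) else 0)"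
    if "i < m * L" "j < n * L" for i j
    using that row col m n index_kron_mat_one[of i A s j] index_kron_mat_one[of i B t j]
    by (simp_all add: M_def eq)
  \<comment> \<open>\<open>C\<close> keeps the top left entry of each \<open>L\<close> by
    \<open>L\<close> block.\<close>
  define C where "C = mat m n (\<lambda>(a, b). M $$ (a * L, b * L))"
  have "M = kron_mat C (1\<^sub>m L)"
  proof (rule eq_matI)
    fix i j assume "i < dim_row (kron_mat C (1\<^sub>m L))" "j < dim_col (kron_mat C (1\<^sub>m L))"
    then have ij: "i < m * L" "j < n * L" by (simp_all add: C_def)
    define a b where "a = i div L" and "b = j div L"
    have ab: "a < m" "b < n" using ij by (simp_all add: a_def b_def less_mult_imp_div_less)
    have R: "kron_mat C (1\<^sub>m L) $$ (i, j) = (if i mod L = j mod L then M $$ (a * L, b * L) else 0)"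
      using ij ab by (subst index_kron_mat_one) (simp_all add: C_def a_def b_def)
    show "M $$ (i, j) = kron_mat C (1\<^sub>m L) $$ (i, j)"
    proof (cases "i mod L = j mod L")
      case False
      then have "i mod s \<noteq> j mod s \<or> i mod t \<noteq> j mod t"
        using cong_cong_lcm_nat[of i j s t] by (auto simp: cong_def L_def)
      then show ?thesis using R False MA[OF ij] MB[OF ij] by auto
    next
      case True
      have bound: "a * L + k < m * L" "b * L + k < n * L" if "k < L" for k
        using ab that by (metis add_less_cancel_left less_le_trans mult_Suc add.commute Suc_leI mult_le_mono1)+
      \<comment> \<open>\<open>h\<close> runs down the main diagonal of block \<open>(a, b)\<close>;
        it starts at the entry stored in \<open>C\<close> and, as the residues modulo
        \<open>L\<close> agree, passes through \<open>(i, j)\<close>.\<close>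
      define h where "h k = M $$ (a * L + k, b * L + k)" for k
      have "h (Suc k) = h k" if k: "Suc k < L" for k
      proof -
        \<comment> \<open>A diagonal step keeps the difference of the indices, so both entries
          vanish or both are read from the factor, at the same quotients.\<close>
        have step: "(x mod d = y mod d) = (Suc x mod d = Suc y mod d)" if "0 < d" for x y d :: nat
          using cong_add_rcancel_nat[of x 1 y d] by (simp add: cong_def)
        note b = bound[OF k] bound[OF Suc_lessD[OF k]]
        show ?thesis
          using Suc_div_in_lcm_block[OF k[unfolded L_def], folded L_def]
        proof
          assume "\<forall>a. (a * L + Suc k) div s = (a * L + k) div s"
          then show ?thesis
            using MA[OF b(1,2)] MA[OF b(3,4)] step[OF s, of "a * L + k" "b * L + k"]
            by (simp add: h_def)
        next
          assume "\<forall>a. (a * L + Suc k) div t = (a * L + k) div t"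
          then show ?thesis
            using MB[OF b(1,2)] MB[OF b(3,4)] step[OF t, of "a * L + k" "b * L + k"]
            by (simp add: h_def)
        qed
      qed
      then have "h (i mod L) = h 0"
        using L by (intro constant_below[of L h]) auto
      moreover have "a * L + i mod L = i" "b * L + i mod L = j"
        unfolding a_def b_def by (simp, simp only: True div_mult_mod_eq)
      ultimately show ?thesis using R True by (simp add: h_def)
    qed
  qed (simp_all add: C_def m n)
  moreover have "C \<in> all_mats" using \<open>0 < m\<close> \<open>0 < n\<close> by (simp add: C_def all_mats_def)
  ultimately show ?thesis unfolding M_def L_def by blast
qed

text \<open>An all-ones factor has no zeros, so no residue condition arises: it suffices that the
  vector is constant on blocks of length \<open>L\<close>.\<close>

lemma kron_vec_lcm:
  fixes X Y :: "'a::semiring_1 vec"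
  assumes eq: "kron_vec X (ones_vec s) = kron_vec Y (ones_vec t)" and s: "0 < s" and t: "0 < t"
    and X: "X \<in> all_vecs"
  shows "\<exists>Z\<in>all_vecs. kron_vec X (ones_vec s) = kron_vec Z (ones_vec (lcm s t))"
proof -
  define V where "V = kron_vec X (ones_vec s)"
  define L where "L = lcm s t"
  have L: "0 < L" using s t by (simp add: L_def lcm_pos_nat)
  have dim: "dim_vec V = dim_vec X * s" "dim_vec V = dim_vec Y * t"
    by (simp add: V_def, simp add: V_def eq)
  have "L dvd dim_vec V"
    unfolding L_def using dim by (metis dvd_triv_right lcm_least)
  then obtain m where m: "dim_vec V = m * L"
    by (metis dvd_def mult.commute)
  have "0 < m"
    using X dim(1) m s by (auto simp: all_vecs_def intro: Nat.gr0I)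
  have VX: "V $ i = X $ (i div s)" and VY: "V $ i = Y $ (i div t)" if "i < m * L" for i
    using that dim m index_kron_vec_ones[of i X s] index_kron_vec_ones[of i Y t]
    by (simp_all add: V_def eq)
  define Z where "Z = vec m (\<lambda>a. V $ (a * L))"
  have "V = kron_vec Z (ones_vec L)"
  proof (rule eq_vecI)
    fix i assume "i < dim_vec (kron_vec Z (ones_vec L))"
    then have i: "i < m * L" by (simp add: Z_def)
    define a where "a = i div L"
    have a: "a < m" using i by (simp add: a_def less_mult_imp_div_less)
    have bound: "a * L + k < m * L" if "k < L" for k
      using a that by (metis add_less_cancel_left less_le_trans mult_Suc add.commute Suc_leI mult_le_mono1)
    define h where "h k = V $ (a * L + k)" for k
    have "h (Suc k) = h k" if k: "Suc k < L" for k
      using Suc_div_in_lcm_block[OF k[unfolded L_def], folded L_def]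
        VX[OF bound[OF k]] VX[OF bound[OF Suc_lessD[OF k]]]
        VY[OF bound[OF k]] VY[OF bound[OF Suc_lessD[OF k]]]
      by (auto simp: h_def)
    then have "h (i mod L) = h 0"
      using L by (intro constant_below[of L h]) auto
    moreover have "a * L + i mod L = i" by (simp add: a_def)
    moreover have "kron_vec Z (ones_vec L) $ i = V $ (a * L)"
      using i a by (subst index_kron_vec_ones) (simp_all add: Z_def a_def)
    ultimately show "V $ i = kron_vec Z (ones_vec L) $ i" by (simp add: h_def)
  qed (simp add: Z_def m)
  moreover have "Z \<in> all_vecs" using \<open>0 < m\<close> by (simp add: Z_def all_vecs_def)
  ultimately show ?thesis unfolding V_def L_def by blast
qed

section \<open>The two actions\<close>

interpretation mat_action: nat_action "all_mats :: 'a::semiring_1 mat set" "\<lambda>A s. kron_mat A (1\<^sub>m s)"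
proof
  fix A :: "'a mat" and s t :: nat
  show "kron_mat A (1\<^sub>m 1) = A"
    by (rule eq_matI) (simp_all add: index_kron_mat_one)
  show "kron_mat (kron_mat A (1\<^sub>m s)) (1\<^sub>m t) = kron_mat A (1\<^sub>m (s * t))"
  proof (rule eq_matI)
    fix i j assume "i < dim_row (kron_mat A (1\<^sub>m (s * t)))" "j < dim_col (kron_mat A (1\<^sub>m (s * t)))"
    then have ij: "i < dim_row A * (s * t)" "j < dim_col A * (s * t)" by simp_all
    then have ij': "i < dim_row A * s * t" "j < dim_col A * s * t" by (simp_all add: mult.assoc)
    then have "i div t < dim_row A * s" "j div t < dim_col A * s"
      by (simp_all add: less_mult_imp_div_less)
    moreover have "x div (s * t) = x div t div s" for x
      by (simp add: div_mult2_eq mult.commute[of s])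
    ultimately show "kron_mat (kron_mat A (1\<^sub>m s)) (1\<^sub>m t) $$ (i, j) = kron_mat A (1\<^sub>m (s * t)) $$ (i, j)"
      using ij ij' by (auto simp: index_kron_mat_one mod_mult_eq_iff)
  qed (simp_all add: mult.assoc)
next
  fix A B :: "'a mat" and s :: nat
  assume s: "0 < s" and eq: "kron_mat A (1\<^sub>m s) = kron_mat B (1\<^sub>m s)"
  have dim: "dim_row A = dim_row B" "dim_col A = dim_col B"
    using arg_cong[OF eq, of dim_row] arg_cong[OF eq, of dim_col] s by simp_all
  show "A = B"
  proof (rule eq_matI)
    fix i j assume "i < dim_row B" "j < dim_col B"
    then show "A $$ (i, j) = B $$ (i, j)"
      \<comment> \<open>The block corner has quotients \<open>i\<close>, \<open>j\<close> and
        residues 0, so it shows the factor's own entry.\<close>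
      using arg_cong[OF eq, of "\<lambda>M. M $$ (i * s, j * s)"] s dim
      by (simp add: index_kron_mat_one)
  qed (use dim in auto)
next
  fix A :: "'a mat" and s t :: nat
  assume "A \<in> all_mats" and "kron_mat A (1\<^sub>m s) = kron_mat A (1\<^sub>m t)"
  then show "s = t"
    by (metis (mono_tags, lifting) all_mats_def dim_kron_mat_one(1) less_not_refl mem_Collect_eq mult_cancel1)
qed (simp add: all_mats_def, rule kron_mat_lcm)

interpretation vec_action: nat_action "all_vecs :: 'a::semiring_1 vec set" "\<lambda>X s. kron_vec X (ones_vec s)"
proof
  fix X :: "'a vec" and s t :: nat
  show "kron_vec X (ones_vec 1) = X"
    by (rule eq_vecI) (simp_all add: index_kron_vec_ones)
  show "kron_vec (kron_vec X (ones_vec s)) (ones_vec t) = kron_vec X (ones_vec (s * t))"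
  proof (rule eq_vecI)
    fix i assume "i < dim_vec (kron_vec X (ones_vec (s * t)))"
    then have i: "i < dim_vec X * (s * t)" by simp
    then have i': "i < dim_vec X * s * t" by (simp add: mult.assoc)
    then have "i div t < dim_vec X * s"
      by (simp add: less_mult_imp_div_less)
    moreover have "i div (s * t) = i div t div s"
      by (simp add: div_mult2_eq mult.commute[of s])
    ultimately show "kron_vec (kron_vec X (ones_vec s)) (ones_vec t) $ i = kron_vec X (ones_vec (s * t)) $ i"
      using i i' by (simp add: index_kron_vec_ones)
  qed (simp add: mult.assoc)
next
  fix X Y :: "'a vec" and s :: nat
  assume s: "0 < s" and eq: "kron_vec X (ones_vec s) = kron_vec Y (ones_vec s)"
  have dim: "dim_vec X = dim_vec Y"
    using arg_cong[OF eq, of dim_vec] s by simp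
  show "X = Y"
  proof (rule eq_vecI)
    fix i assume "i < dim_vec Y"
    then show "X $ i = Y $ i"
      using arg_cong[OF eq, of "\<lambda>V. V $ (i * s)"] s dim
      by (simp add: index_kron_vec_ones)
  qed (use dim in auto)
next
  fix X :: "'a vec" and s t :: nat
  assume "X \<in> all_vecs" and "kron_vec X (ones_vec s) = kron_vec X (ones_vec t)"
  then show "s = t"
    by (metis (mono_tags, lifting) all_vecs_def dim_kron_vec_ones less_not_refl mem_Collect_eq mult_cancel1)
qed (simp add: all_vecs_def, rule kron_vec_lcm)

section \<open>The two classes as copies of divisibility\<close>

lemma dvd_gorder_mat_class:
  assumes "A \<in> all_mats" "mat_irreducible A"
  shows "dvd_gorder (mat_class_order A) (\<lambda>s. kron_mat A (1\<^sub>m s))"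
  using mat_action.dvd_gorder_class[OF assms(1)] assms(2)
  by (simp add: mat_irreducible_def mat_class_order_def mat_class_def mat_equiv_def
      mat_prec_def[abs_def])

lemma dvd_gorder_vec_class:
  assumes "X \<in> all_vecs" "vec_irreducible X"
  shows "dvd_gorder (vec_class_order X) (\<lambda>s. kron_vec X (ones_vec s))"
proof -
  have "\<not> (\<exists>Z\<in>all_vecs. \<exists>k\<ge>2. X = kron_vec Z (ones_vec k))"
    using assms(2) by (auto simp: vec_irreducible_def)
  from vec_action.dvd_gorder_class[OF assms(1) this] show ?thesis
    by (simp add: vec_class_order_def vec_class_def vec_equiv_def vec_leq_def[abs_def])
qed

theorem proposition207:
  fixes A1 :: "'a::field_char_0 mat" and X1 :: "'a vec"
  assumes "A1 \<in> all_mats" and "mat_irreducible A1"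
    and "X1 \<in> all_vecs" and "vec_irreducible X1"
  shows "\<exists>\<phi>. (\<forall>s\<ge>1. \<phi> (kron_mat A1 (1\<^sub>m s)) = kron_vec X1 (ones_vec s)) \<and>
             lattice_iso (mat_class_order A1) (vec_class_order X1) \<phi>"
  using lattice_iso_dvd_gorder[OF dvd_gorder_mat_class dvd_gorder_vec_class] assms by blast

end
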